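(* Let $R$ be a commutative ring with unity, let $k\geq 1$ be an integer, and let $\mathcal{I}\subseteq R$ be an ideal satisfying the unital set condition. Then the reduction map $SL_k(R)\to SL_k(R/\mathcal{I})$ is surjective, where $SL_k(S)=\{A\in M_k(S)\mid \det(A)=1\}$.
   Context: A finite list $a_1,\dots,a_k$ of elements of $R$ (repetitions allowed) is called a unital set if the ideal $(a_1,\dots,a_k)$ equals $R$. An ideal $\mathcal{I}\subseteq R$ satisfies the unital set condition (USC) if for every unital set $\{a_1,\dots,a_k\}\subseteq R$ with $k\ge 2$ there exists $j\in(a_2,\dots,a_k)$ such that $a_1+j$ is a unit modulo $\mathcal{I}$. *)

theory Defs
  imports
    "HOL-Algebra.QuotRing"
    "HOL-Combinatorics.Permutations"
    "Jordan_Normal_Form.Matrix"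
begin

text \<open>Matrices are the dimension-indexed matrices of \<^theory>\<open>Jordan_Normal_Form.Matrix\<close>,
  with entries in an explicit carrier. The determinant of that library needs the entry type
  to be a commutative ring, which excludes quotient rings (their elements are cosets) and the
  zero ring, so the Leibniz formula is restated for a ring record.\<close>

definition mats :: "('a, 'm) ring_scheme \<Rightarrow> nat \<Rightarrow> 'a mat set" where
  "mats S k = {A \<in> carrier_mat k k. elements_mat A \<subseteq> carrier S}"

definition ring_det :: "('a, 'm) ring_scheme \<Rightarrow> 'a mat \<Rightarrow> 'a" where
  "ring_det S A =
    (\<Oplus>\<^bsub>S\<^esub> p \<in> {p. p permutes {0..<dim_row A}}.
       (let t = (\<Otimes>\<^bsub>S\<^esub> i \<in> {0..<dim_row A}. A $$ (i, p i))
        in if evenperm p then t else \<ominus>\<^bsub>S\<^esub> t))"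

definition SL :: "nat \<Rightarrow> ('a, 'm) ring_scheme \<Rightarrow> 'a mat set" where
  "SL k S = {A \<in> mats S k. ring_det S A = \<one>\<^bsub>S\<^esub>}"

definition reduction :: "('a, 'm) ring_scheme \<Rightarrow> 'a set \<Rightarrow> 'a mat \<Rightarrow> 'a set mat" where
  "reduction R I = map_mat (\<lambda>x. I +>\<^bsub>R\<^esub> x)"

definition unital_set :: "('a, 'm) ring_scheme \<Rightarrow> 'a list \<Rightarrow> bool" where
  "unital_set R as \<longleftrightarrow> set as \<subseteq> carrier R \<and> Idl\<^bsub>R\<^esub> (set as) = carrier R"

definition unit_modulo :: "('a, 'm) ring_scheme \<Rightarrow> 'a set \<Rightarrow> 'a \<Rightarrow> bool" where
  "unit_modulo R I x \<longleftrightarrow> I +>\<^bsub>R\<^esub> x \<in> Units (R Quot I)"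

definition unital_set_condition :: "('a, 'm) ring_scheme \<Rightarrow> 'a set \<Rightarrow> bool" where
  "unital_set_condition R I \<longleftrightarrow>
    (\<forall>as. unital_set R as \<and> length as \<ge> 2 \<longrightarrow>
       (\<exists>j \<in> Idl\<^bsub>R\<^esub> (set (tl as)). unit_modulo R I (hd as \<oplus>\<^bsub>R\<^esub> j)))"

end

(* Row operations preserve the determinant and can be undone after lifting, so it suffices to
   row reduce modulo I. If A has determinant 1 modulo I, the last column of A together with the
   element x = 1 - det A of I generates R; the unital set condition turns the corner entry into
   a unit modulo I by row operations, and then the last column can be made the last unit vector
   modulo I. The leading block has determinant 1 modulo I, so it lifts by induction on the size,
   and completing the lift by an exact last unit vector as last column keeps the determinant 1. *)

theory Submission
  imports Defs
begin

section \<open>Determinants of matrices given as functions of two indices\<close>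

definition leibniz_term ::
    "('a, 'm) ring_scheme \<Rightarrow> nat \<Rightarrow> (nat \<Rightarrow> nat \<Rightarrow> 'a) \<Rightarrow> (nat \<Rightarrow> nat) \<Rightarrow> 'a" where
  "leibniz_term S n f p =
    (let t = (\<Otimes>\<^bsub>S\<^esub> i \<in> {0..<n}. f i (p i)) in if evenperm p then t else \<ominus>\<^bsub>S\<^esub> t)"

definition leibniz_det :: "('a, 'm) ring_scheme \<Rightarrow> nat \<Rightarrow> (nat \<Rightarrow> nat \<Rightarrow> 'a) \<Rightarrow> 'a" where
  "leibniz_det S n f = (\<Oplus>\<^bsub>S\<^esub> p \<in> {p. p permutes {0..<n}}. leibniz_term S n f p)"

lemma ring_det_eq_leibniz_det:
  "ring_det S A = leibniz_det S (dim_row A) (\<lambda>i j. A $$ (i, j))"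
  by (simp add: ring_det_def leibniz_det_def leibniz_term_def)

text \<open>Values outside the \<open>n\<close> by \<open>n\<close> square stay unconstrained. The
  leading block of a matrix is therefore the same function read with a smaller \<open>n\<close>, and
  no submatrices have to be formed.\<close>

definition entries :: "('a, 'm) ring_scheme \<Rightarrow> nat \<Rightarrow> (nat \<Rightarrow> nat \<Rightarrow> 'a) set" where
  "entries S n = {f. \<forall>i<n. \<forall>j<n. f i j \<in> carrier S}"

lemma entriesD: "f \<in> entries S n \<Longrightarrow> i < n \<Longrightarrow> j < n \<Longrightarrow> f i j \<in> carrier S"
  by (simp add: entries_def)

lemma entries_Suc: "f \<in> entries S (Suc n) \<Longrightarrow> f \<in> entries S n"
  by (simp add: entries_def)

definition add_row ::
    "('a, 'm) ring_scheme \<Rightarrow> nat \<Rightarrow> 'a \<Rightarrow> nat \<Rightarrow> (nat \<Rightarrow> nat \<Rightarrow> 'a) \<Rightarrow> nat \<Rightarrow> nat \<Rightarrow> 'a" where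
  "add_row S a c b f = f(a := (\<lambda>j. f a j \<oplus>\<^bsub>S\<^esub> c \<otimes>\<^bsub>S\<^esub> f b j))"

lemma permutes_less: "p permutes {0..<n} \<Longrightarrow> i < n \<Longrightarrow> p i < n" for n :: nat
  using permutes_in_image[of p "{0..<n}" i] by simp

lemma entry_permuted:
  assumes "f \<in> entries S n" and p: "p permutes {0..<n}" and "i < n" "j < n"
  shows "f i (p j) \<in> carrier S"
  using assms(1,3) permutes_less[OF p assms(4)] by (rule entriesD)

context cring
begin

lemma factors_closed:
  assumes "f \<in> entries R n" and "p permutes {0..<n}" and "A \<subseteq> {0..<n}"
  shows "(\<lambda>i. f i (p i)) \<in> A \<rightarrow> carrier R"
  using entry_permuted[OF assms(1,2)] assms(3) by (auto simp: subset_iff)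

lemma leibniz_term_closed:
  assumes "f \<in> entries R n" and "p permutes {0..<n}"
  shows "leibniz_term R n f p \<in> carrier R"
  using factors_closed[OF assms subset_refl] by (simp add: leibniz_term_def Let_def)

lemma leibniz_det_closed: "f \<in> entries R n \<Longrightarrow> leibniz_det R n f \<in> carrier R"
  unfolding leibniz_det_def by (intro finsum_closed) (auto intro: leibniz_term_closed)

lemma leibniz_term_cong:
  assumes "g \<in> entries R n" and "p permutes {0..<n}"
    and "\<And>i j. i < n \<Longrightarrow> j < n \<Longrightarrow> f i j = g i j"
  shows "leibniz_term R n f p = leibniz_term R n g p"
proof -
  have "(\<Otimes>i\<in>{0..<n}. f i (p i)) = (\<Otimes>i\<in>{0..<n}. g i (p i))"
    using assms permutes_less[OF assms(2)] by (intro finprod_cong' factors_closed) auto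
  then show ?thesis by (simp add: leibniz_term_def)
qed

lemma leibniz_det_cong:
  assumes "g \<in> entries R n" and "\<And>i j. i < n \<Longrightarrow> j < n \<Longrightarrow> f i j = g i j"
  shows "leibniz_det R n f = leibniz_det R n g"
  unfolding leibniz_det_def using assms
  by (intro finsum_cong') (auto intro: leibniz_term_closed leibniz_term_cong)

text \<open>The sign is kept with the product over the other rows, so the second factor does not see
  row \<open>a\<close>. This makes each term linear in row \<open>a\<close>, and shows that a term
  lies in any ideal containing its factor from row \<open>a\<close>.\<close>

lemma leibniz_term_eq_row:
  assumes f: "f \<in> entries R n" and p: "p permutes {0..<n}" and a: "a < n"
  shows "leibniz_term R n f p =
    f a (p a) \<otimes> (let t = (\<Otimes>i\<in>{0..<n} - {a}. f i (p i)) in if evenperm p then t else \<ominus> t)"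
proof -
  have cl: "(\<Otimes>i\<in>{0..<n} - {a}. f i (p i)) \<in> carrier R"
    by (intro finprod_closed factors_closed[OF f p]) auto
  have fa: "f a (p a) \<in> carrier R" using f p a by (blast intro: entry_permuted)
  have "(\<Otimes>i\<in>insert a ({0..<n} - {a}). f i (p i))
      = f a (p a) \<otimes> (\<Otimes>i\<in>{0..<n} - {a}. f i (p i))"
    using factors_closed[OF f p, of "{0..<n} - {a}"] fa by (intro finprod_insert) auto
  moreover have "insert a ({0..<n} - {a}) = {0..<n}" using a by auto
  ultimately have "(\<Otimes>i\<in>{0..<n}. f i (p i)) = f a (p a) \<otimes> (\<Otimes>i\<in>{0..<n} - {a}. f i (p i))"
    by simp
  then show ?thesis using cl fa by (simp add: leibniz_term_def Let_def r_minus)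
qed

text \<open>Without dividing by 2: composition with the transposition of the two rows matches the even
  permutations with the odd ones.\<close>

lemma leibniz_det_equal_rows:
  assumes f: "f \<in> entries R n" and ab: "a < n" "b < n" "a \<noteq> b"
    and eq: "\<And>j. j < n \<Longrightarrow> f a j = f b j"
  shows "leibniz_det R n f = \<zero>"
proof -
  define t where "t = Transposition.transpose a b"
  define h where "h = (\<lambda>p :: nat \<Rightarrow> nat. p \<circ> t)"
  let ?P = "{p. p permutes {0..<n}}"
  define E where "E = {p \<in> ?P. evenperm p}"
  define D where "D = {p \<in> ?P. \<not> evenperm p}"
  have t: "t permutes {0..<n}" unfolding t_def using ab by (intro permutes_swap_id) auto
  have tt: "t \<circ> t = id" by (simp add: t_def)
  have perm_t: "permutation t" by (simp add: t_def permutation_swap_id)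
  have perm: "permutation p" if "p permutes {0..<n}" for p
    using that permutes_imp_permutation by blast
  have odd: "evenperm (h p) \<longleftrightarrow> \<not> evenperm p" if "p permutes {0..<n}" for p
    unfolding h_def using evenperm_comp[OF perm[OF that] perm_t] ab(3)
    by (simp add: t_def evenperm_swap)
  have hP: "h p permutes {0..<n}" if "p permutes {0..<n}" for p
    unfolding h_def using permutes_compose[OF t that] .
  have hh: "h (h p) = p" for p by (simp add: h_def comp_assoc tt)
  have img: "h ` E = D"
  proof (intro equalityI subsetI)
    fix p assume "p \<in> D"
    then have "h p \<in> E" using hP odd by (auto simp: D_def E_def)
    then show "p \<in> h ` E" by (metis hh imageI)
  qed (auto simp: D_def E_def hP odd)
  \<comment> \<open>Reindexing the product along \<open>t\<close> turns \<open>p\<close> into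
    \<open>h p\<close>, and since rows \<open>a\<close> and \<open>b\<close> agree,
    \<open>f (t i)\<close> may be read as \<open>f i\<close>. The two products coincide, so only the
    sign differs.\<close>
  have neg: "leibniz_term R n f (h p) = \<ominus> leibniz_term R n f p" if p: "p \<in> E" for p
  proof -
    have pp: "p permutes {0..<n}" "evenperm p" using p by (auto simp: E_def)
    have row: "f (t i) j = f i j" if "j < n" for i j
      using eq[OF that] by (auto simp: t_def Transposition.transpose_def)
    have tim: "t ` {0..<n} = {0..<n}" using permutes_image[OF t] .
    have "(\<Otimes>i\<in>{0..<n}. f i (p i)) = (\<Otimes>i\<in>t ` {0..<n}. f i (p i))" by (simp only: tim)
    also have "\<dots> = (\<Otimes>i\<in>{0..<n}. f (t i) (p (t i)))"
      using factors_closed[OF f pp(1) subset_refl] permutes_inj_on[OF t]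
      by (intro finprod_reindex) (simp_all only: tim)
    also have "\<dots> = (\<Otimes>i\<in>{0..<n}. f i (h p i))"
      using factors_closed[OF f hP[OF pp(1)] subset_refl] row permutes_less[OF hP[OF pp(1)]]
      by (intro finprod_cong') (auto simp: h_def)
    finally show ?thesis using odd[OF pp(1)] pp(2) by (simp add: leibniz_term_def)
  qed
  have finP: "finite ?P" by (simp add: finite_permutations)
  have ED: "?P = E \<union> D" "E \<inter> D = {}" "finite E" "finite D"
    using finP by (auto simp: E_def D_def)
  have clP: "leibniz_term R n f \<in> ?P \<rightarrow> carrier R" by (auto intro: leibniz_term_closed[OF f])
  then have clE: "leibniz_term R n f \<in> E \<rightarrow> carrier R"
    and clD: "leibniz_term R n f \<in> D \<rightarrow> carrier R" using ED(1) by auto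
  have "inj_on h E" by (metis hh inj_onI)
  then have "(\<Oplus>p\<in>D. leibniz_term R n f p) = (\<Oplus>p\<in>E. leibniz_term R n f (h p))"
    using finsum_reindex[of "leibniz_term R n f" h E] clD img by simp
  also have "\<dots> = (\<Oplus>p\<in>E. \<ominus> leibniz_term R n f p)"
    using clE neg by (intro finsum_cong') auto
  finally have D: "(\<Oplus>p\<in>D. leibniz_term R n f p) = (\<Oplus>p\<in>E. \<ominus> leibniz_term R n f p)" .
  have "leibniz_det R n f = (\<Oplus>p\<in>E. leibniz_term R n f p) \<oplus> (\<Oplus>p\<in>D. leibniz_term R n f p)"
    unfolding leibniz_det_def ED(1) using ED clE clD by (intro finsum_Un_disjoint) auto
  also have "\<dots> = (\<Oplus>p\<in>E. leibniz_term R n f p \<oplus> \<ominus> leibniz_term R n f p)"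
    unfolding D using clE by (intro finsum_addf[symmetric]) auto
  also have "\<dots> = (\<Oplus>p\<in>E. \<zero>)" using clE by (intro finsum_cong') (auto simp: r_neg Pi_iff)
  finally show ?thesis by simp
qed

lemma add_row_entries:
  assumes "f \<in> entries R n" and "a < n" "b < n" and "c \<in> carrier R"
  shows "add_row R a c b f \<in> entries R n"
  using assms by (auto simp: add_row_def entries_def)

text \<open>By linearity in row \<open>a\<close>, the change is \<open>c\<close> times the
  determinant of the matrix whose row \<open>a\<close> is replaced by row \<open>b\<close>. That
  matrix has two equal rows.\<close>

lemma leibniz_det_add_row:
  assumes f: "f \<in> entries R n" and ab: "a < n" "b < n" "a \<noteq> b" and c: "c \<in> carrier R"
  shows "leibniz_det R n (add_row R a c b f) = leibniz_det R n f"
proof -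
  let ?g = "f(a := f b)" and ?h = "add_row R a c b f"
  let ?P = "{p. p permutes {0..<n}}"
  have g: "?g \<in> entries R n" using f ab by (auto simp: entries_def)
  have h: "?h \<in> entries R n" using f ab c by (intro add_row_entries)
  have lin: "leibniz_term R n ?h p = leibniz_term R n f p \<oplus> c \<otimes> leibniz_term R n ?g p"
    if p: "p permutes {0..<n}" for p
  proof -
    let ?t = "\<Otimes>i\<in>{0..<n} - {a}. f i (p i)"
    have cl: "?t \<in> carrier R" by (intro finprod_closed factors_closed[OF f p]) auto
    have fc: "f a (p a) \<in> carrier R" "f b (p a) \<in> carrier R"
      using f p ab by (auto intro: entry_permuted)
    \<comment> \<open>The three matrices differ only in row \<open>a\<close>, so they share the
      product over the remaining rows.\<close>
    have "(\<Otimes>i\<in>{0..<n} - {a}. ?h i (p i)) = ?t" "(\<Otimes>i\<in>{0..<n} - {a}. ?g i (p i)) = ?t"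
      using factors_closed[OF f p, of "{0..<n} - {a}"]
      by (auto intro!: finprod_cong' simp: add_row_def split: if_splits)
    then show ?thesis
      unfolding leibniz_term_eq_row[OF f p ab(1)] leibniz_term_eq_row[OF g p ab(1)]
        leibniz_term_eq_row[OF h p ab(1)]
      using cl fc c by (simp add: add_row_def Let_def l_distr m_assoc)
  qed
  have "leibniz_det R n ?h
      = (\<Oplus>p\<in>?P. leibniz_term R n f p \<oplus> c \<otimes> leibniz_term R n ?g p)"
    unfolding leibniz_det_def using c leibniz_term_closed[OF f] leibniz_term_closed[OF g]
    by (intro finsum_cong') (auto simp: lin)
  also have "\<dots> = leibniz_det R n f \<oplus> (\<Oplus>p\<in>?P. c \<otimes> leibniz_term R n ?g p)"
    unfolding leibniz_det_def using c leibniz_term_closed[OF f] leibniz_term_closed[OF g]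
    by (intro finsum_addf) auto
  also have "(\<Oplus>p\<in>?P. c \<otimes> leibniz_term R n ?g p) = c \<otimes> leibniz_det R n ?g"
    unfolding leibniz_det_def using c leibniz_term_closed[OF g]
    by (intro finsum_rdistr[symmetric]) (auto simp: finite_permutations)
  also have "leibniz_det R n ?g = \<zero>"
    using ab(3) by (intro leibniz_det_equal_rows[OF g ab]) auto
  finally show ?thesis using c leibniz_det_closed[OF f] by simp
qed

text \<open>Every permutation sends some row to column \<open>k\<close>, so every term of the
  expansion has a factor in \<open>J\<close>. Applied to the ideal generated by a column and one
  further element, this will show that the ideal contains the determinant.\<close>

lemma leibniz_det_in_ideal:
  assumes f: "f \<in> entries R n" and J: "ideal J R" and k: "k < n"
    and col: "\<And>i. i < n \<Longrightarrow> f i k \<in> J"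
  shows "leibniz_det R n f \<in> J"
proof -
  interpret J: ideal J R by (rule J)
  have mem: "leibniz_term R n f p \<in> J" if p: "p permutes {0..<n}" for p
  proof -
    obtain a where a: "a < n" "p a = k"
      using permutes_image[OF p] k by (metis atLeastLessThan_iff image_iff le0)
    have "(\<Otimes>i\<in>{0..<n} - {a}. f i (p i)) \<in> carrier R"
      by (intro finprod_closed factors_closed[OF f p]) auto
    then show ?thesis
      unfolding leibniz_term_eq_row[OF f p a(1)] a(2) Let_def
      by (intro J.I_r_closed col a) auto
  qed
  have "(\<Oplus>p\<in>A. leibniz_term R n f p) \<in> J"
    if "finite A" "A \<subseteq> {p. p permutes {0..<n}}" for A
    using that
  proof (induction A rule: finite_induct)
    case (insert p A)
    have "(\<Oplus>p\<in>insert p A. leibniz_term R n f p)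
        = leibniz_term R n f p \<oplus> (\<Oplus>p\<in>A. leibniz_term R n f p)"
      using insert by (intro finsum_insert) (auto intro: leibniz_term_closed[OF f])
    then show ?case using insert mem by auto
  qed simp
  then show ?thesis unfolding leibniz_det_def by (simp add: finite_permutations)
qed

text \<open>With the last instead of the first column the permutations that contribute are literally
  those of the smaller index set, with the same parity.\<close>

lemma leibniz_det_last_column:
  assumes f: "f \<in> entries R (Suc n)"
    and col: "\<And>i. i < n \<Longrightarrow> f i n = \<zero>" "f n n = \<one>"
  shows "leibniz_det R (Suc n) f = leibniz_det R n f"
proof -
  let ?P = "{p. p permutes {0..<Suc n}}" and ?Q = "{p. p permutes {0..<n}}"
  have sub: "?Q \<subseteq> ?P" by (auto intro: permutes_subset)
  have zero: "leibniz_term R (Suc n) f p = \<zero>" if p: "p \<in> ?P - ?Q" for p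
  proof -
    have pp: "p permutes {0..<Suc n}" using p by simp
    obtain a where a: "a < Suc n" "p a = n"
      using permutes_image[OF pp] by (metis atLeastLessThan_iff image_iff le0 lessI)
    \<comment> \<open>A permutation fixing \<open>n\<close> already permutes \<open>{0..<n}\<close>.
      Here column \<open>n\<close> is thus reached from an earlier row, where its entry is
      zero.\<close>
    have "a \<noteq> n"
    proof
      assume "a = n"
      then have "p permutes {0..<n}"
        using permutes_superset[OF pp, of "{0..<n}"] a(2) by (auto simp: less_Suc_eq)
      then show False using p by simp
    qed
    then have fa: "f a (p a) = \<zero>" using a col(1) by simp
    have "(\<Otimes>i\<in>{0..<Suc n} - {a}. f i (p i)) \<in> carrier R"
      by (intro finprod_closed factors_closed[OF f pp]) auto
    then show ?thesis
      unfolding leibniz_term_eq_row[OF f pp a(1)] fa Let_def by auto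
  qed
  have same: "leibniz_term R (Suc n) f p = leibniz_term R n f p" if p: "p \<in> ?Q" for p
  proof -
    have pn: "p n = n" using p permutes_not_in[of p "{0..<n}" n] by simp
    have cl: "(\<lambda>i. f i (p i)) \<in> {0..<n} \<rightarrow> carrier R"
      using p by (intro factors_closed[OF entries_Suc[OF f]]) auto
    have "(\<Otimes>i\<in>{0..<Suc n}. f i (p i)) = f n (p n) \<otimes> (\<Otimes>i\<in>{0..<n}. f i (p i))"
      unfolding atLeast0_lessThan_Suc
      using cl pn col(2) by (intro finprod_insert) auto
    then show ?thesis using cl pn col(2) by (simp add: leibniz_term_def)
  qed
  have "leibniz_det R (Suc n) f = (\<Oplus>p\<in>?Q. leibniz_term R (Suc n) f p)"
    unfolding leibniz_det_def using sub zero
    by (intro add.finprod_mono_neutral_cong_right)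
       (auto simp: finite_permutations intro: leibniz_term_closed[OF f])
  also have "\<dots> = leibniz_det R n f"
    unfolding leibniz_det_def using same
    by (intro finsum_cong') (auto intro: leibniz_term_closed[OF entries_Suc[OF f]])
  finally show ?thesis .
qed

lemma leibniz_det_1: "f \<in> entries R (Suc 0) \<Longrightarrow> leibniz_det R (Suc 0) f = f 0 0"
  by (simp add: leibniz_det_def leibniz_term_def entries_def)

end

text \<open>The determinant is built from sums, products and signs of the entries, all of which
  \<open>h\<close> respects.\<close>

lemma (in ring_hom_cring) hom_leibniz_det:
  assumes f: "f \<in> entries R n"
  shows "h (leibniz_det R n f) = leibniz_det S n (\<lambda>i j. h (f i j))"
proof -
  have hf: "(\<lambda>i j. h (f i j)) \<in> entries S n" using f by (auto simp: entries_def)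
  have "h (leibniz_term R n f p) = leibniz_term S n (\<lambda>i j. h (f i j)) p"
    if "p permutes {0..<n}" for p
    using R.factors_closed[OF f that subset_refl]
    by (simp add: leibniz_term_def Let_def hom_finprod comp_def)
  then show ?thesis
    unfolding leibniz_det_def
    using R.leibniz_term_closed[OF f] S.leibniz_term_closed[OF hf]
    by (subst hom_finsum) (auto intro!: S.finsum_cong')
qed


section \<open>Row reduction and generators of ideals\<close>

text \<open>Only additions of a multiple of one row to a different row are allowed. Without scalings
  and swaps the determinant is kept exactly, and each step is undone by a step of the same
  kind.\<close>

inductive row_reduces ::
    "('a, 'm) ring_scheme \<Rightarrow> nat \<Rightarrow> (nat \<Rightarrow> nat \<Rightarrow> 'a) \<Rightarrow> (nat \<Rightarrow> nat \<Rightarrow> 'a) \<Rightarrow> bool"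
  for S n f where
  refl: "row_reduces S n f f"
| step: "\<lbrakk>row_reduces S n f g; a < n; b < n; a \<noteq> b; c \<in> carrier S\<rbrakk>
    \<Longrightarrow> row_reduces S n f (add_row S a c b g)"

lemma row_reduces_trans:
  assumes "row_reduces S n g e" and "row_reduces S n f g"
  shows "row_reduces S n f e"
  using assms by (induction rule: row_reduces.induct) (auto intro: row_reduces.step)

lemma (in cring) row_reduces_entries:
  "row_reduces R n f g \<Longrightarrow> f \<in> entries R n \<Longrightarrow> g \<in> entries R n"
  by (induction rule: row_reduces.induct) (auto intro: add_row_entries)

lemma (in cring) row_reduces_det:
  "row_reduces R n f g \<Longrightarrow> f \<in> entries R n \<Longrightarrow> leibniz_det R n g = leibniz_det R n f"
  by (induction rule: row_reduces.induct)
     (auto simp: leibniz_det_add_row row_reduces_entries)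

text \<open>The sum of the principal ideal of \<open>a\<close> and \<open>Idl A\<close> is an ideal
  containing all the generators, hence contains \<open>j\<close> by minimality. Splitting off one
  generator at a time lets each generator be matched with one row operation.\<close>

lemma (in cring) genideal_insertE:
  assumes "a \<in> carrier R" "A \<subseteq> carrier R" and j: "j \<in> Idl (insert a A)"
  obtains r y where "r \<in> carrier R" "y \<in> Idl A" "j = r \<otimes> a \<oplus> y"
proof -
  let ?K = "set_add R (PIdl a) (Idl A)"
  interpret A: ideal "Idl A" R using assms by (intro genideal_ideal)
  interpret P: ideal "PIdl a" R using assms by (intro cgenideal_ideal)
  have K: "ideal ?K R" by (rule add_ideals[OF P.is_ideal A.is_ideal])
  have mem: "u \<oplus> v \<in> ?K" if "u \<in> PIdl a" "v \<in> Idl A" for u v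
    using that by (auto simp: set_add_def')
  have "a \<in> ?K"
    using mem[OF cgenideal_self[OF assms(1)] A.zero_closed] assms(1) by simp
  moreover have "A \<subseteq> ?K"
  proof
    fix y assume "y \<in> A"
    then have "y \<in> Idl A" "y \<in> carrier R" using genideal_self[OF assms(2)] assms(2) by auto
    then show "y \<in> ?K" using mem[OF P.zero_closed, of y] by simp
  qed
  ultimately have "j \<in> ?K" using genideal_minimal[OF K, of "insert a A"] j by auto
  then obtain u y where u: "u \<in> PIdl a" "y \<in> Idl A" "j = u \<oplus> y"
    unfolding set_add_def' by blast
  then obtain r where "r \<in> carrier R" "u = r \<otimes> a" unfolding cgenideal_def by blast
  then show ?thesis using that u by blast
qed

section \<open>Lifting matrices of determinant one along a homomorphism\<close>

context ring_hom_cring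
begin

text \<open>A matrix over \<open>S\<close> is handled through a representative \<open>f\<close> over
  \<open>R\<close>. The determinant of \<open>f\<close> itself may differ from one; only the images
  of its entries matter.\<close>

definition lifts_to_det_one :: "nat \<Rightarrow> (nat \<Rightarrow> nat \<Rightarrow> 'a) \<Rightarrow> bool" where
  "lifts_to_det_one n f \<longleftrightarrow>
    (\<exists>g \<in> entries R n. leibniz_det R n g = \<one>\<^bsub>R\<^esub> \<and> (\<forall>i<n. \<forall>j<n. h (g i j) = h (f i j)))"

text \<open>A lift of the modified matrix becomes a lift of \<open>f\<close> by subtracting
  \<open>c\<close> times row \<open>b\<close> from row \<open>a\<close>. Row \<open>b\<close> is
  untouched by both operations because \<open>a\<close> and \<open>b\<close> differ.\<close>

lemma lifts_to_det_one_add_row: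
  assumes f: "f \<in> entries R n" and ab: "a < n" "b < n" "a \<noteq> b" and c: "c \<in> carrier R"
    and l: "lifts_to_det_one n (add_row R a c b f)"
  shows "lifts_to_det_one n f"
proof -
  obtain g where g: "g \<in> entries R n" "leibniz_det R n g = \<one>\<^bsub>R\<^esub>"
    and gf: "\<And>i j. i < n \<Longrightarrow> j < n \<Longrightarrow> h (g i j) = h (add_row R a c b f i j)"
    using l unfolding lifts_to_det_one_def by blast
  let ?g = "add_row R a (\<ominus>\<^bsub>R\<^esub> c) b g"
  have "h (?g i j) = h (f i j)" if ij: "i < n" "j < n" for i j
  proof (cases "i = a")
    case True
    have cl: "g a j \<in> carrier R" "g b j \<in> carrier R" "f a j \<in> carrier R" "f b j \<in> carrier R"
      using f g(1) ab ij by (auto intro: entriesD)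
    have "h (g a j) = h (f a j) \<oplus>\<^bsub>S\<^esub> h c \<otimes>\<^bsub>S\<^esub> h (f b j)"
      using gf[OF ab(1) ij(2)] cl c by (simp add: add_row_def)
    moreover have "h (g b j) = h (f b j)"
      using gf[OF ab(2) ij(2)] ab(3) by (simp add: add_row_def)
    ultimately show ?thesis
      using True cl c by (simp add: add_row_def S.l_minus S.a_assoc S.r_neg)
  qed (use gf[OF ij] in \<open>simp add: add_row_def\<close>)
  moreover have "?g \<in> entries R n" "leibniz_det R n ?g = \<one>\<^bsub>R\<^esub>"
    using g ab c by (auto intro!: R.add_row_entries simp: R.leibniz_det_add_row)
  ultimately show ?thesis unfolding lifts_to_det_one_def by blast
qed

lemma lifts_to_det_one_row_reduces:
  "row_reduces R n f g \<Longrightarrow> f \<in> entries R n \<Longrightarrow> lifts_to_det_one n g \<Longrightarrow> lifts_to_det_one n f"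
  by (induction rule: row_reduces.induct)
     (auto intro: lifts_to_det_one_add_row R.row_reduces_entries)

text \<open>This realizes the element \<open>j\<close> supplied by the unital set condition. Each
  generator \<open>f l m\<close> contributes one operation from row \<open>l\<close> to row
  \<open>k\<close>, while a multiple of \<open>x\<close> needs none, since \<open>h\<close> kills
  it.\<close>

lemma row_reduces_add_combination:
  assumes f: "f \<in> entries R n" and k: "k < n" "m < n" and x: "x \<in> carrier R" "h x = \<zero>\<^bsub>S\<^esub>"
    and ls: "set ls \<subseteq> {0..<n} - {k}" and j: "j \<in> Idl\<^bsub>R\<^esub> (set (map (\<lambda>l. f l m) ls @ [x]))"
  shows "\<exists>g. row_reduces R n f g \<and> (\<forall>i. i \<noteq> k \<longrightarrow> g i = f i) \<and> h (g k m) = h (f k m \<oplus>\<^bsub>R\<^esub> j)"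
  using ls j
proof (induction ls arbitrary: j)
  case Nil
  \<comment> \<open>With no rows left, \<open>j\<close> is a multiple of \<open>x\<close> and lies
    in the kernel, so the matrix can stay as it is.\<close>
  have "Idl\<^bsub>R\<^esub> {x} \<subseteq> a_kernel R S h"
  proof (rule R.genideal_minimal[OF ring.kernel_is_ideal])
    show "{x} \<subseteq> a_kernel R S h" using x unfolding a_kernel_def' by simp
  qed
  then have "j \<in> a_kernel R S h" using Nil.prems by auto
  then have "j \<in> carrier R" "h j = \<zero>\<^bsub>S\<^esub>" unfolding a_kernel_def' by simp_all
  then have "h (f k m) = h (f k m \<oplus>\<^bsub>R\<^esub> j)" using entriesD[OF f k] by simp
  then show ?case by (blast intro: row_reduces.refl)
next
  case (Cons l ls)
  have l: "l < n" "l \<noteq> k" using Cons.prems by auto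
  have cl: "f l m \<in> carrier R" "f k m \<in> carrier R" using f k l by (auto intro: entriesD)
  have sub: "set (map (\<lambda>l. f l m) ls @ [x]) \<subseteq> carrier R"
    using Cons.prems k x by (auto intro!: entriesD[OF f])
  obtain r y where r: "r \<in> carrier R" and y: "y \<in> Idl\<^bsub>R\<^esub> (set (map (\<lambda>l. f l m) ls @ [x]))"
    and jry: "j = r \<otimes>\<^bsub>R\<^esub> f l m \<oplus>\<^bsub>R\<^esub> y"
    using R.genideal_insertE[OF cl(1) sub] Cons.prems by auto
  have yc: "y \<in> carrier R"
    using y R.genideal_ideal[OF sub] by (meson ideal.Icarr)
  obtain g where g: "row_reduces R n f g" "\<forall>i. i \<noteq> k \<longrightarrow> g i = f i"
    "h (g k m) = h (f k m \<oplus>\<^bsub>R\<^esub> y)"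
    using Cons.IH[OF _ y] Cons.prems by auto
  have gc: "g k m \<in> carrier R"
    using R.row_reduces_entries[OF g(1) f] k by (rule entriesD)
  \<comment> \<open>Row \<open>l\<close> still equals \<open>f l\<close> after the earlier
    operations, so this adds exactly \<open>r\<close> times the generator
    \<open>f l m\<close>.\<close>
  let ?g = "add_row R k r l g"
  have "row_reduces R n f ?g" using g(1) k l r by (intro row_reduces.step) auto
  moreover have "\<forall>i. i \<noteq> k \<longrightarrow> ?g i = f i" using g(2) by (simp add: add_row_def)
  moreover have "h (?g k m) = h (f k m \<oplus>\<^bsub>R\<^esub> j)"
    using g l r cl gc yc by (simp add: add_row_def jry S.a_ac)
  ultimately show ?case by blast
qed

text \<open>Row \<open>n\<close> serves as the pivot row and never changes; \<open>m\<close> counts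
  the rows treated so far. The pivot is one only under \<open>h\<close>, so the entries above it
  vanish only under \<open>h\<close>.\<close>

lemma row_reduces_clear_last_column:
  assumes f: "f \<in> entries R (Suc n)" and 1: "h (f n n) = \<one>\<^bsub>S\<^esub>" and "m \<le> n"
  shows "\<exists>g. row_reduces R (Suc n) f g \<and> g n = f n \<and> (\<forall>i<m. h (g i n) = \<zero>\<^bsub>S\<^esub>)"
  using \<open>m \<le> n\<close>
proof (induction m)
  case 0
  show ?case by (auto intro: row_reduces.refl)
next
  case (Suc m)
  then obtain g where g: "row_reduces R (Suc n) f g" "g n = f n" "\<forall>i<m. h (g i n) = \<zero>\<^bsub>S\<^esub>"
    by auto
  have cl: "g m n \<in> carrier R" "f n n \<in> carrier R"
    using R.row_reduces_entries[OF g(1) f] f Suc.prems by (auto intro: entriesD)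
  let ?g = "add_row R m (\<ominus>\<^bsub>R\<^esub> g m n) n g"
  have "row_reduces R (Suc n) f ?g" using g(1) cl Suc.prems by (intro row_reduces.step) auto
  moreover have "?g n = f n" using g(2) Suc.prems by (simp add: add_row_def)
  moreover have "\<forall>i<Suc m. h (?g i n) = \<zero>\<^bsub>S\<^esub>"
    using g cl 1 by (auto simp: add_row_def less_Suc_eq S.r_neg)
  ultimately show ?case by blast
qed

lemma lifts_to_det_one_last_column:
  assumes f: "f \<in> entries R (Suc n)" and det: "h (leibniz_det R (Suc n) f) = \<one>\<^bsub>S\<^esub>"
    and col: "\<And>i. i < n \<Longrightarrow> h (f i n) = \<zero>\<^bsub>S\<^esub>" "h (f n n) = \<one>\<^bsub>S\<^esub>"
    and block: "h (leibniz_det R n f) = \<one>\<^bsub>S\<^esub> \<Longrightarrow> lifts_to_det_one n f"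
  shows "lifts_to_det_one (Suc n) f"
proof -
  let ?hf = "\<lambda>i j. h (f i j)"
  have hf: "?hf \<in> entries S (Suc n)" using f by (auto simp: entries_def)
  have "h (leibniz_det R n f) = leibniz_det S n ?hf"
    by (rule hom_leibniz_det[OF entries_Suc[OF f]])
  also have "\<dots> = leibniz_det S (Suc n) ?hf"
    using col by (intro S.leibniz_det_last_column[symmetric] hf) auto
  also have "\<dots> = \<one>\<^bsub>S\<^esub>" using hom_leibniz_det[OF f] det by simp
  finally obtain g where g: "g \<in> entries R n" "leibniz_det R n g = \<one>\<^bsub>R\<^esub>"
    "\<forall>i<n. \<forall>j<n. h (g i j) = h (f i j)"
    using block unfolding lifts_to_det_one_def by blast
  \<comment> \<open>The block comes from \<open>g\<close>, the last column is an exact unit vector,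
    and the rest of the bottom row is kept from \<open>f\<close>. Only the first two differ from
    \<open>f\<close>, and not under \<open>h\<close>.\<close>
  define e where "e = (\<lambda>i j. if i < n \<and> j < n then g i j
    else if j = n then (if i = n then \<one>\<^bsub>R\<^esub> else \<zero>\<^bsub>R\<^esub>) else f i j)"
  have e: "e \<in> entries R (Suc n)"
    using f g(1) by (auto simp: e_def entries_def less_Suc_eq)
  have "leibniz_det R (Suc n) e = leibniz_det R n e"
    by (rule R.leibniz_det_last_column[OF e]) (auto simp: e_def)
  also have "\<dots> = leibniz_det R n g"
    by (rule R.leibniz_det_cong[OF g(1)]) (auto simp: e_def)
  finally have "leibniz_det R (Suc n) e = \<one>\<^bsub>R\<^esub>" using g(2) by simp
  moreover have "h (e i j) = h (f i j)" if "i < Suc n" "j < Suc n" for i j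
    using that g(3) col by (auto simp: e_def less_Suc_eq)
  ultimately show ?thesis using e unfolding lifts_to_det_one_def by blast
qed

text \<open>A unit in the corner cannot be scaled to one by row additions. It is used to make the
  image of the top entry one, and that entry then corrects the corner; \<open>n > 0\<close> makes
  row \<open>0\<close> distinct from row \<open>n\<close>.\<close>

lemma row_reduces_last_column:
  assumes surj: "h ` carrier R = carrier S"
    and usc: "\<And>as. unital_set R as \<Longrightarrow> length as \<ge> 2 \<Longrightarrow>
      \<exists>j \<in> Idl\<^bsub>R\<^esub> (set (tl as)). h (hd as \<oplus>\<^bsub>R\<^esub> j) \<in> Units S"
    and f: "f \<in> entries R (Suc n)" and det: "h (leibniz_det R (Suc n) f) = \<one>\<^bsub>S\<^esub>"
    and n: "n > 0"
  shows "\<exists>g. row_reduces R (Suc n) f g \<and> (\<forall>i<n. h (g i n) = \<zero>\<^bsub>S\<^esub>) \<and> h (g n n) = \<one>\<^bsub>S\<^esub>"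
proof -
  let ?d = "leibniz_det R (Suc n) f"
  define x where "x = \<one>\<^bsub>R\<^esub> \<ominus>\<^bsub>R\<^esub> ?d"
  have d: "?d \<in> carrier R" by (rule R.leibniz_det_closed[OF f])
  have x: "x \<in> carrier R" "h x = \<zero>\<^bsub>S\<^esub>"
    using d det by (simp_all add: x_def R.minus_eq S.r_neg)
  \<comment> \<open>The corner comes first, being the element that the condition \<open>usc\<close>
    modifies. The ideal of the column contains \<open>?d\<close>, and \<open>x\<close> supplies the
    missing difference from one.\<close>
  let ?as = "f n n # (map (\<lambda>l. f l n) [0..<n] @ [x])"
  let ?J = "Idl\<^bsub>R\<^esub> (set ?as)"
  have sub: "set ?as \<subseteq> carrier R" using x by (auto intro: entriesD[OF f])
  interpret J: ideal ?J R by (rule R.genideal_ideal[OF sub])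
  have gen: "set ?as \<subseteq> ?J" by (rule R.genideal_self[OF sub])
  have "?d \<in> ?J"
    using gen by (intro R.leibniz_det_in_ideal[OF f J.is_ideal, of n]) (auto simp: less_Suc_eq)
  moreover have "x \<in> ?J" using gen by simp
  ultimately have "x \<oplus>\<^bsub>R\<^esub> ?d \<in> ?J" by (intro J.a_closed)
  moreover have "x \<oplus>\<^bsub>R\<^esub> ?d = \<one>\<^bsub>R\<^esub>" using d by (simp add: x_def R.minus_eq R.a_assoc R.l_neg)
  ultimately have "?J = carrier R" by (intro J.one_imp_carrier) simp
  then have "unital_set R ?as" using sub by (simp add: unital_set_def)
  from usc[OF this] obtain j where
    j: "j \<in> Idl\<^bsub>R\<^esub> (set (map (\<lambda>l. f l n) [0..<n] @ [x]))" "h (f n n \<oplus>\<^bsub>R\<^esub> j) \<in> Units S"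
    by auto
  obtain g1 where g1: "row_reduces R (Suc n) f g1" "h (g1 n n) \<in> Units S"
  proof -
    have "set [0..<n] \<subseteq> {0..<Suc n} - {n}" by auto
    then show ?thesis
      using row_reduces_add_combination[OF f _ _ x _ j(1), of n] j(2) that by auto
  qed
  have e1: "g1 \<in> entries R (Suc n)" by (rule R.row_reduces_entries[OF g1(1) f])
  \<comment> \<open>The inverse of the corner exists only in \<open>S\<close>; \<open>v\<close> is a
    preimage of it.\<close>
  obtain v where v: "v \<in> carrier R" "h v \<otimes>\<^bsub>S\<^esub> h (g1 n n) = \<one>\<^bsub>S\<^esub>"
    using S.Units_l_inv_ex[OF g1(2)] surj by (metis imageE)
  have c1: "g1 0 n \<in> carrier R" "g1 n n \<in> carrier R" using e1 by (auto intro: entriesD)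
  \<comment> \<open>Under \<open>h\<close>, \<open>c\<close> times the corner is the amount by which
    the top entry falls short of one.\<close>
  define c where "c = (\<one>\<^bsub>R\<^esub> \<ominus>\<^bsub>R\<^esub> g1 0 n) \<otimes>\<^bsub>R\<^esub> v"
  have cc: "c \<in> carrier R" using c1 v by (simp add: c_def)
  define g2 where "g2 = add_row R 0 c n g1"
  have r2: "row_reduces R (Suc n) f g2"
    unfolding g2_def using g1(1) n cc by (intro row_reduces.step) auto
  have "h c \<otimes>\<^bsub>S\<^esub> h (g1 n n) = \<one>\<^bsub>S\<^esub> \<ominus>\<^bsub>S\<^esub> h (g1 0 n)"
    using c1 v by (simp add: c_def R.minus_eq S.minus_eq S.m_assoc)
  then have g2: "h (g2 0 n) = \<one>\<^bsub>S\<^esub>"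
    using c1 cc by (simp add: g2_def add_row_def S.minus_eq S.a_lcomm S.r_neg)
  have e2: "g2 \<in> entries R (Suc n)" by (rule R.row_reduces_entries[OF r2 f])
  have c2: "g2 0 n \<in> carrier R" "g2 n n \<in> carrier R" using e2 by (auto intro: entriesD)
  \<comment> \<open>The top entry now maps to one, so this multiple of row \<open>0\<close> moves
    the image of the corner to one.\<close>
  define g3 where "g3 = add_row R n (\<one>\<^bsub>R\<^esub> \<ominus>\<^bsub>R\<^esub> g2 n n) 0 g2"
  have r3: "row_reduces R (Suc n) f g3"
    unfolding g3_def using r2 n c2 by (intro row_reduces.step) auto
  have g3: "h (g3 n n) = \<one>\<^bsub>S\<^esub>"
    using c2 g2 by (simp add: g3_def add_row_def R.minus_eq S.a_lcomm S.r_neg)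
  obtain g where "row_reduces R (Suc n) g3 g" "g n = g3 n" "\<forall>i<n. h (g i n) = \<zero>\<^bsub>S\<^esub>"
    using row_reduces_clear_last_column[OF R.row_reduces_entries[OF r3 f] g3 order_refl] by blast
  then show ?thesis using row_reduces_trans[OF _ r3] g3 by metis
qed

lemma lifts_to_det_one:
  assumes surj: "h ` carrier R = carrier S"
    and usc: "\<And>as. unital_set R as \<Longrightarrow> length as \<ge> 2 \<Longrightarrow>
      \<exists>j \<in> Idl\<^bsub>R\<^esub> (set (tl as)). h (hd as \<oplus>\<^bsub>R\<^esub> j) \<in> Units S"
    and "f \<in> entries R (Suc n)" and "h (leibniz_det R (Suc n) f) = \<one>\<^bsub>S\<^esub>"
  shows "lifts_to_det_one (Suc n) f"
  using assms(3,4)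
proof (induction n arbitrary: f)
  case 0
  \<comment> \<open>In size one the determinant is the entry itself, which maps to one, so the
    matrix with entry one is a lift.\<close>
  have one: "(\<lambda>_ _. \<one>\<^bsub>R\<^esub>) \<in> entries R (Suc 0)" by (simp add: entries_def)
  show ?case
    unfolding lifts_to_det_one_def using 0 R.leibniz_det_1[OF one] one
    by (intro bexI[of _ "\<lambda>_ _. \<one>\<^bsub>R\<^esub>"]) (auto simp: R.leibniz_det_1)
next
  case (Suc n)
  obtain g where g: "row_reduces R (Suc (Suc n)) f g"
    "\<forall>i<Suc n. h (g i (Suc n)) = \<zero>\<^bsub>S\<^esub>" "h (g (Suc n) (Suc n)) = \<one>\<^bsub>S\<^esub>"
    using row_reduces_last_column[OF surj usc Suc.prems] by blast
  have e: "g \<in> entries R (Suc (Suc n))" by (rule R.row_reduces_entries[OF g(1) Suc.prems(1)])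
  have "h (leibniz_det R (Suc (Suc n)) g) = \<one>\<^bsub>S\<^esub>"
    using R.row_reduces_det[OF g(1) Suc.prems(1)] Suc.prems(2) by simp
  then have "lifts_to_det_one (Suc (Suc n)) g"
    \<comment> \<open>The induction hypothesis is applied to the same \<open>g\<close> read in the
      smaller size, which is its leading block.\<close>
    using g Suc.IH[OF entries_Suc[OF e]] by (intro lifts_to_det_one_last_column[OF e]) auto
  then show ?case by (rule lifts_to_det_one_row_reduces[OF g(1) Suc.prems(1)])
qed

end

section \<open>Transfer to matrices and the quotient ring\<close>

lemma mats_iff:
  "A \<in> mats S k \<longleftrightarrow> A \<in> carrier_mat k k \<and> (\<lambda>i j. A $$ (i, j)) \<in> entries S k"
  by (auto simp: mats_def entries_def subset_iff dest!: elements_matD intro: elements_matI)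

lemma SL_iff:
  "A \<in> SL k S \<longleftrightarrow> A \<in> carrier_mat k k \<and> (\<lambda>i j. A $$ (i, j)) \<in> entries S k
    \<and> leibniz_det S k (\<lambda>i j. A $$ (i, j)) = \<one>\<^bsub>S\<^esub>"
  by (auto simp: SL_def mats_iff ring_det_eq_leibniz_det)

theorem mainTheorem2:
  fixes R :: "('a, 'm) ring_scheme" and I :: "'a set" and k :: nat
  assumes "cring R"
    and "k \<ge> 1"
    and "ideal I R"
    and "unital_set_condition R I"
  shows "reduction R I ` SL k R = SL k (R Quot I)"
proof -
  let ?S = "R Quot I" and ?h = "(+>\<^bsub>R\<^esub>) I"
  interpret h: ring_hom_cring R ?S ?h
    by (rule ideal.rcos_ring_hom_cring[OF assms(3,1)])
  have surj: "?h ` carrier R = carrier ?S"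
    unfolding FactRing_def A_RCOSETS_def' by auto
  have usc: "\<exists>j \<in> Idl\<^bsub>R\<^esub> (set (tl as)). ?h (hd as \<oplus>\<^bsub>R\<^esub> j) \<in> Units ?S"
    if "unital_set R as" "length as \<ge> 2" for as
    using assms(4) that by (auto simp: unital_set_condition_def unit_modulo_def)
  have entry: "reduction R I A $$ (i, j) = ?h (A $$ (i, j))"
    if "A \<in> carrier_mat k k" "i < k" "j < k" for A i j
    using that by (simp add: reduction_def)
  show ?thesis
  proof (intro equalityI subsetI)
    fix B assume "B \<in> reduction R I ` SL k R"
    then obtain A where A: "A \<in> SL k R" and B: "B = reduction R I A" by blast
    let ?f = "\<lambda>i j. A $$ (i, j)"
    have f: "?f \<in> entries R k" "leibniz_det R k ?f = \<one>\<^bsub>R\<^esub>" and Ac: "A \<in> carrier_mat k k"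
      using A by (auto simp: SL_iff)
    have hf: "(\<lambda>i j. ?h (?f i j)) \<in> entries ?S k" using f(1) by (auto simp: entries_def)
    have eq: "B $$ (i, j) = ?h (?f i j)" if "i < k" "j < k" for i j
      using entry[OF Ac that] B by simp
    have "leibniz_det ?S k (\<lambda>i j. B $$ (i, j)) = leibniz_det ?S k (\<lambda>i j. ?h (?f i j))"
      by (rule h.S.leibniz_det_cong[OF hf eq])
    also have "\<dots> = \<one>\<^bsub>?S\<^esub>" using h.hom_leibniz_det[OF f(1)] f(2) by simp
    finally show "B \<in> SL k ?S"
      using hf eq Ac B by (simp add: SL_iff entries_def reduction_def)
  next
    fix B assume "B \<in> SL k ?S"
    then have Bc: "B \<in> carrier_mat k k" and Be: "(\<lambda>i j. B $$ (i, j)) \<in> entries ?S k"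
      and Bd: "leibniz_det ?S k (\<lambda>i j. B $$ (i, j)) = \<one>\<^bsub>?S\<^esub>" by (auto simp: SL_iff)
    \<comment> \<open>Representatives are chosen entry by entry, so the determinant of
      \<open>f\<close> is one only modulo \<open>I\<close>.\<close>
    define f where "f = (\<lambda>i j. SOME x. x \<in> carrier R \<and> ?h x = B $$ (i, j))"
    have f: "f i j \<in> carrier R \<and> ?h (f i j) = B $$ (i, j)" if "i < k" "j < k" for i j
    proof -
      have "B $$ (i, j) \<in> ?h ` carrier R" using entriesD[OF Be that] surj by simp
      then have "\<exists>x. x \<in> carrier R \<and> ?h x = B $$ (i, j)" by auto
      then show ?thesis unfolding f_def by (rule someI_ex)
    qed
    have fe: "f \<in> entries R k" using f by (simp add: entries_def)
    have "leibniz_det ?S k (\<lambda>i j. ?h (f i j)) = \<one>\<^bsub>?S\<^esub>"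
      using h.S.leibniz_det_cong[OF Be, of "\<lambda>i j. ?h (f i j)"] f Bd by simp
    then have fd: "?h (leibniz_det R k f) = \<one>\<^bsub>?S\<^esub>" using h.hom_leibniz_det[OF fe] by simp
    \<comment> \<open>The lifting result starts at size one; \<open>k \<ge> 1\<close> supplies the
      predecessor.\<close>
    obtain n where k: "k = Suc n" using assms(2) by (cases k) auto
    have "h.lifts_to_det_one k f"
      using h.lifts_to_det_one[OF surj usc, of f n] fe fd k by blast
    then obtain g where g: "g \<in> entries R k" "leibniz_det R k g = \<one>\<^bsub>R\<^esub>"
      "\<And>i j. i < k \<Longrightarrow> j < k \<Longrightarrow> ?h (g i j) = ?h (f i j)"
      unfolding h.lifts_to_det_one_def by blast
    define A where "A = mat k k (\<lambda>(i, j). g i j)"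
    have Ac: "A \<in> carrier_mat k k" by (simp add: A_def)
    have Ag: "A $$ (i, j) = g i j" if "i < k" "j < k" for i j using that by (simp add: A_def)
    have "leibniz_det R k (\<lambda>i j. A $$ (i, j)) = \<one>\<^bsub>R\<^esub>"
      using h.R.leibniz_det_cong[OF g(1), of "\<lambda>i j. A $$ (i, j)"] Ag g(2) by simp
    then have "A \<in> SL k R" using Ac Ag g(1) by (simp add: SL_iff entries_def)
    moreover have "reduction R I A = B"
    proof (rule eq_matI)
      fix i j assume "i < dim_row B" "j < dim_col B"
      then have ij: "i < k" "j < k" using Bc by auto
      then show "reduction R I A $$ (i, j) = B $$ (i, j)"
        using entry[OF Ac ij] Ag[OF ij] g(3)[OF ij] f[OF ij] by simp
    qed (use Ac Bc in \<open>auto simp: reduction_def\<close>)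
    ultimately show "B \<in> reduction R I ` SL k R" by blast
  qed
qed

end
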